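(* Let $D\ge 1$ be a fixed ambient dimension, let $\mathcal M\subset\mathbb R^D$ be a smooth embedded Riemannian manifold of dimension $d$, $1\le d\le D$, and let $f:\mathcal M\to[0,\infty)$ be a probability density with respect to the volume form of $\mathcal M$. Let $\mathcal C=(C_i)_{i=1}^m$ be a family of pairwise disjoint, compact and connected sets contained in $\mathcal M$ such that $C=\bigcup_{i=1}^m C_i$ has positive reach $\tau>0$. Suppose that there are constants $a_1>a_0>0$ with $f(x)\ge a_1$ for all $x\in C$ and $f(x)\le a_0$ for all $x\in\mathcal M\setminus C$. Then there exists a constant $\beta_0\ge 0$, depending on the diameters of the $C_i$'s, the reach $\tau$ of $C$ and the intrinsic dimension $d$ (with $D$ fixed), such that for all $$\alpha>1+d\,\frac{\beta_0}{\log(a_1/a_0)},$$ the macroscopic clustering problem $(\mathcal C,f)$ is $\alpha$-feasible. If, moreover, the length of geodesics in $C$ is uniformly bounded by some $R<\infty$, then the constant $\beta_0$ can be taken independent of $d$ (depending on $R$, the diameters of the $C_i$'s and $\tau$), so that the lower bound on $\alpha$ is linear in $d$.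
   Context: $|\cdot|$ is the Euclidean norm on $\mathbb R^D$. Macroscopic Fermat distance: for $\alpha\ge 1$ and $x,y\in\mathcal M$, $$D^d_\alpha(x,y)=\inf_{\gamma\in\Gamma_{x,y}}\int_\gamma \frac{1}{f^{(\alpha-1)/d}},$$ where $\Gamma_{x,y}$ is the set of rectifiable paths $\gamma:[0,1]\to\mathcal M$ with $\gamma(0)=x$, $\gamma(1)=y$, the integral is with respect to Euclidean arc length, and the value may be $+\infty$. $\alpha$-feasibility: $(\mathcal C,f)$ is $\alpha$-feasible (equivalently, $\mathcal C$ are $\alpha$-clusters of $f$) if there exists $\epsilon>0$ such that $$D^d_\alpha(x,y)\le D^d_\alpha(x,y')-\epsilon\quad\text{for all } 1\le i\le m,\ j\ne i,\ x,y\in C_i,\ y'\in C_j.$$ Reach: for $C\subset\mathbb R^D$ let $d_C(x)=\inf_{y\in C}|x-y|$ and $C^r=\{x\in\mathbb R^D: d_C(x)\le r\}$. The reach $\mathrm{rch}(C)\in[0,\infty]$ is the supremum of the values $r>0$ such that for every $y\in C^r$ there exists a unique $x\in C$ with $|x-y|=d_C(y)$. Geodesics in $C$: a geodesic in $C$ between two points of the same $C_i$ is a rectifiable path of minimal Euclidean length among paths joining the two points inside $C_i$. "The length of geodesics in $C$ is uniformly bounded by $R$" means that for every $i$, any two points of $C_i$ are joined by such a path of length at most $R$. *)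

theory Defs
  imports "HOL-Analysis.Analysis"
begin

section \<open>Embedded submanifolds and their volume\<close>

(* Only meant for open S, where the full Frechet derivative makes sense. *)
primrec Ck_on :: "nat \<Rightarrow> 'a::euclidean_space set \<Rightarrow> ('a \<Rightarrow> 'b::euclidean_space) \<Rightarrow> bool" where
  "Ck_on 0 S f \<longleftrightarrow> continuous_on S f"
| "Ck_on (Suc k) S f \<longleftrightarrow>
     (\<forall>x\<in>S. f differentiable (at x)) \<and> (\<forall>v. Ck_on k S (\<lambda>x. frechet_derivative f (at x) v))"

definition smooth_on :: "'a::euclidean_space set \<Rightarrow> ('a \<Rightarrow> 'b::euclidean_space) \<Rightarrow> bool" where
  "smooth_on S f \<longleftrightarrow> (\<forall>k. Ck_on k S f)"

(* A diffeomorphism \<phi> : U \<rightarrow> W between open subsets of the ambient space, with inverse \<psi>, that maps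
   M \<inter> U onto the slice of W in the coordinate subspace span B, card B = d.  The role of R^d is
   played by span B, so that the dimension d can be an ordinary natural number. *)
definition slice_chart ::
  "nat \<Rightarrow> 'a::euclidean_space set \<Rightarrow> 'a set \<Rightarrow> 'a set \<Rightarrow> 'a set \<Rightarrow> ('a \<Rightarrow> 'a) \<Rightarrow> ('a \<Rightarrow> 'a) \<Rightarrow> bool"
where
  "slice_chart d M B U W \<phi> \<psi> \<longleftrightarrow>
     B \<subseteq> Basis \<and> card B = d \<and> open U \<and> open W \<and> homeomorphism U W \<phi> \<psi> \<and>
     smooth_on U \<phi> \<and> smooth_on W \<psi> \<and> \<phi> ` (M \<inter> U) = W \<inter> span B"

definition smooth_submanifold :: "nat \<Rightarrow> 'a::euclidean_space set \<Rightarrow> bool" where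
  "smooth_submanifold d M \<longleftrightarrow>
     (\<forall>p\<in>M. \<exists>B U W \<phi> \<psi>. slice_chart d M B U W \<phi> \<psi> \<and> p \<in> U)"

(* The determinant of the metric tensor g_bc = \<langle>\<partial>_b \<psi>, \<partial>_c \<psi>\<rangle> (b, c \<in> B) induced by the Euclidean inner
   product, written by the Leibniz formula because the index set B is not a type. *)
definition metric_det :: "'a::euclidean_space set \<Rightarrow> ('a \<Rightarrow> 'a) \<Rightarrow> 'a \<Rightarrow> real" where
  "metric_det B \<psi> z =
     (\<Sum>p | p permutes B. of_int (sign p) *
        (\<Prod>b\<in>B. frechet_derivative \<psi> (at z) b \<bullet> frechet_derivative \<psi> (at z) (p b)))"

(* Lebesgue measure of dimension card B on span B, as a measure on the ambient space
   (compare lborel_eq, which is the case B = Basis). *)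
definition coord_lborel :: "'a::euclidean_space set \<Rightarrow> 'a measure" where
  "coord_lborel B = distr (\<Pi>\<^sub>M b\<in>B. lborel) borel (\<lambda>u. \<Sum>b\<in>B. u b *\<^sub>R b)"

(* \<mu> is the Riemannian volume of M: in every chart it is sqrt (det g) du_1 ... du_d.  As countably
   many charts cover M, this determines \<mu> uniquely. *)
definition riemannian_volume :: "nat \<Rightarrow> 'a::euclidean_space set \<Rightarrow> 'a measure \<Rightarrow> bool" where
  "riemannian_volume d M \<mu> \<longleftrightarrow>
     sets \<mu> = sets (restrict_space borel M) \<and>
     (\<forall>B U W \<phi> \<psi>. slice_chart d M B U W \<phi> \<psi> \<longrightarrow>
        (\<forall>A\<in>sets borel. A \<subseteq> M \<inter> U \<longrightarrow>
           emeasure \<mu> A =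
             (\<integral>\<^sup>+ z. ennreal (sqrt (metric_det B \<psi> z)) * indicator {z \<in> W. \<psi> z \<in> A} z
                \<partial>coord_lborel B)))"

(* Only the values of f on M matter. *)
definition prob_density_on :: "nat \<Rightarrow> 'a::euclidean_space set \<Rightarrow> ('a \<Rightarrow> real) \<Rightarrow> bool" where
  "prob_density_on d M f \<longleftrightarrow>
     f \<in> borel_measurable (restrict_space borel M) \<and> (\<forall>x\<in>M. 0 \<le> f x) \<and>
     (\<exists>\<mu>. riemannian_volume d M \<mu> \<and> (\<integral>\<^sup>+ x. ennreal (f x) \<partial>\<mu>) = 1)"


section \<open>Rectifiable paths and arc length\<close>

definition arc_length :: "(real \<Rightarrow> 'a::euclidean_space) \<Rightarrow> real \<Rightarrow> real \<Rightarrow> ennreal" where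
  "arc_length \<gamma> a b =
     (SUP (n, t) \<in> {(n::nat, t). mono_on {..n} t \<and> t ` {..n} \<subseteq> {a..b}}.
        ennreal (\<Sum>i<n. dist (\<gamma> (t i)) (\<gamma> (t (Suc i)))))"

definition rectifiable_paths ::
  "'a::euclidean_space set \<Rightarrow> 'a \<Rightarrow> 'a \<Rightarrow> (real \<Rightarrow> 'a) set" where
  "rectifiable_paths S x y =
     {\<gamma>. path \<gamma> \<and> path_image \<gamma> \<subseteq> S \<and> pathstart \<gamma> = x \<and> pathfinish \<gamma> = y \<and> arc_length \<gamma> 0 1 < \<infinity>}"

(* The Stieltjes measure ds of the arc length function s(t) = length of \<gamma> on [0,t], which is
   extended by constants outside [0,1]; s is continuous for rectifiable \<gamma>. *)
definition arc_measure :: "(real \<Rightarrow> 'a::euclidean_space) \<Rightarrow> real measure" where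
  "arc_measure \<gamma> = interval_measure (\<lambda>t. enn2real (arc_length \<gamma> 0 (max 0 (min 1 t))))"

definition arc_integral :: "(real \<Rightarrow> 'a::euclidean_space) \<Rightarrow> ('a \<Rightarrow> ennreal) \<Rightarrow> ennreal" where
  "arc_integral \<gamma> w = (\<integral>\<^sup>+ t\<in>{0..1}. w (\<gamma> t) \<partial>arc_measure \<gamma>)"


section \<open>Macroscopic Fermat distance and feasibility\<close>

(* 1 / f^((\<alpha>-1)/d), with value \<infinity> where f = 0 and \<alpha> > 1.  The case \<alpha> = 1 is separate because
   0 powr 0 = 0, whereas the weight has to be 1 there. *)
definition fermat_weight :: "nat \<Rightarrow> real \<Rightarrow> ('a \<Rightarrow> real) \<Rightarrow> 'a \<Rightarrow> ennreal" where
  "fermat_weight d \<alpha> f z = (if \<alpha> = 1 then 1 else 1 / ennreal (f z powr ((\<alpha> - 1) / real d)))"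

definition fermat_dist ::
  "nat \<Rightarrow> real \<Rightarrow> 'a::euclidean_space set \<Rightarrow> ('a \<Rightarrow> real) \<Rightarrow> 'a \<Rightarrow> 'a \<Rightarrow> ennreal" where
  "fermat_dist d \<alpha> M f x y =
     (INF \<gamma> \<in> rectifiable_paths M x y. arc_integral \<gamma> (fermat_weight d \<alpha> f))"

(* Stated in ereal because subtraction on ennreal is truncated at 0. *)
definition alpha_feasible ::
  "nat \<Rightarrow> real \<Rightarrow> 'a::euclidean_space set \<Rightarrow> nat \<Rightarrow> (nat \<Rightarrow> 'a set) \<Rightarrow> ('a \<Rightarrow> real) \<Rightarrow> bool" where
  "alpha_feasible d \<alpha> M m C f \<longleftrightarrow>
     (\<exists>\<epsilon>::real. 0 < \<epsilon> \<and>
        (\<forall>i\<in>{1..m}. \<forall>j\<in>{1..m} - {i}. \<forall>x\<in>C i. \<forall>y\<in>C i. \<forall>y'\<in>C j.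
           enn2ereal (fermat_dist d \<alpha> M f x y) \<le> enn2ereal (fermat_dist d \<alpha> M f x y') - ereal \<epsilon>))"


section \<open>Reach, geodesics, and the standing assumptions\<close>

definition reach :: "'a::euclidean_space set \<Rightarrow> ennreal" where
  "reach C =
     (SUP r \<in> {r::real. 0 < r \<and>
                 (\<forall>y. infdist y C \<le> r \<longrightarrow> (\<exists>!x. x \<in> C \<and> dist x y = infdist y C))}.
        ennreal r)"

definition geodesics_in ::
  "'a::euclidean_space set \<Rightarrow> 'a \<Rightarrow> 'a \<Rightarrow> (real \<Rightarrow> 'a) set" where
  "geodesics_in S x y =
     {\<gamma> \<in> rectifiable_paths S x y.
        \<forall>\<gamma>'\<in>rectifiable_paths S x y. arc_length \<gamma> 0 1 \<le> arc_length \<gamma>' 0 1}"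

definition geodesics_bounded ::
  "nat \<Rightarrow> (nat \<Rightarrow> 'a::euclidean_space set) \<Rightarrow> real \<Rightarrow> bool" where
  "geodesics_bounded m C R \<longleftrightarrow>
     0 \<le> R \<and>
     (\<forall>i\<in>{1..m}. \<forall>x\<in>C i. \<forall>y\<in>C i. \<exists>\<gamma>\<in>geodesics_in (C i) x y. arc_length \<gamma> 0 1 \<le> ennreal R)"

definition clustering_setting ::
  "nat \<Rightarrow> 'a::euclidean_space set \<Rightarrow> ('a \<Rightarrow> real) \<Rightarrow> nat \<Rightarrow> (nat \<Rightarrow> 'a set) \<Rightarrow> real \<Rightarrow> real \<Rightarrow> bool"
where
  "clustering_setting d M f m C a\<^sub>0 a\<^sub>1 \<longleftrightarrow>
     1 \<le> d \<and> d \<le> DIM('a) \<and> smooth_submanifold d M \<and> prob_density_on d M f \<and>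
     (\<forall>i\<in>{1..m}. compact (C i) \<and> connected (C i) \<and> C i \<subseteq> M) \<and>
     disjoint_family_on C {1..m} \<and>
     0 < reach (\<Union>i\<in>{1..m}. C i) \<and>
     0 < a\<^sub>0 \<and> a\<^sub>0 < a\<^sub>1 \<and>
     (\<forall>x\<in>(\<Union>i\<in>{1..m}. C i). a\<^sub>1 \<le> f x) \<and>
     (\<forall>x\<in>M - (\<Union>i\<in>{1..m}. C i). f x \<le> a\<^sub>0)"

definition diameters :: "nat \<Rightarrow> (nat \<Rightarrow> 'a::metric_space set) \<Rightarrow> real list" where
  "diameters m C = map (\<lambda>i. diameter (C i)) [1..<Suc m]"

end

theory Submission
  imports Defs
begin

text \<open>
  Let \<open>r\<close> be half the reach of \<open>C\<close>.  A fixed point argument shows that the nearest-point projection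
  is constant on normal segments up to length \<open>r\<close>, and Federer's inequality
  \<open>(x - p) \<bullet> (a - p) \<le> |x - p| |a - p|\<^sup>2 / (2 r)\<close> for \<open>a \<in> C\<close> and the projection \<open>p\<close> of \<open>x\<close> makes it
  2-Lipschitz at distance up to \<open>r / 2\<close>.  Projecting segments, any two points of \<open>C\<close> at distance at
  most \<open>r\<close> are joined in \<open>C\<close> by a path of length \<open>2 r\<close>.  Hence distinct clusters are more than \<open>r\<close>
  apart, and chaining through a cover of a connected cluster by \<open>N\<close> balls of radius \<open>r / 2\<close> joins any
  two of its points by a path of length at most \<open>\<kappa> r\<close> with \<open>\<kappa> = 2 (N\<^sup>2 + 2)\<close>.  With
  \<open>s = (\<alpha> - 1) / d\<close>, Fermat distances inside a cluster are therefore at most \<open>\<kappa> r / a\<^sub>1\<^sup>s\<close>, whereas a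
  path leaving a cluster for another one crosses a collar of width \<open>r\<close> outside \<open>C\<close> and costs at least
  \<open>r / a\<^sub>0\<^sup>s\<close>.  So \<open>\<beta>\<^sub>0 = ln \<kappa>\<close> works; \<open>N\<close> depends only on the diameters, the reach and the
  ambient dimension, so the same constant serves both parts.
\<close>

section \<open>The nearest-point projection near a set of positive reach\<close>

lemma closest_point_dist_eq_infdist:
  fixes S :: "'a::euclidean_space set"
  assumes "closed S" "S \<noteq> {}"
  shows "dist a (closest_point S a) = infdist a S"
proof (rule antisym)
  obtain x where "x \<in> S" "infdist a S = dist a x"
    using infdist_attains_inf[OF assms] .
  then show "dist a (closest_point S a) \<le> infdist a S"
    using closest_point_le[OF assms(1)] by simp
  show "infdist a S \<le> dist a (closest_point S a)"
    using closest_point_in_set[OF assms] by (rule infdist_le)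
qed

locale tubular_nbhd =
  fixes C :: "'a::euclidean_space set" and r :: real
  assumes compact_C: "compact C" and nonempty_C: "C \<noteq> {}" and r_pos: "0 < r"
    and unique_nearest: "infdist y C \<le> r \<Longrightarrow> \<exists>!x. x \<in> C \<and> dist x y = infdist y C"
begin

abbreviation proj :: "'a \<Rightarrow> 'a" where "proj \<equiv> closest_point C"

lemma closed_C: "closed C"
  using compact_C by (rule compact_imp_closed)

lemma proj_in: "proj y \<in> C"
  using closed_C nonempty_C by (rule closest_point_in_set)

lemma dist_proj: "dist y (proj y) = infdist y C"
  using closed_C nonempty_C by (rule closest_point_dist_eq_infdist)

lemma proj_unique:
  assumes "infdist y C \<le> r" "x \<in> C" "dist y x \<le> infdist y C"
  shows "proj y = x"
  using unique_nearest[OF assms(1)] proj_in dist_proj assms infdist_le[OF assms(2), of y]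
  by (metis antisym dist_commute)

text \<open>A map into a compact set is continuous if its graph is closed. Uniqueness of the nearest
  point yields closed conditions for the graph: for \<open>x\<close> in \<open>C\<close>,
  \<open>dist y x \<le> infdist y C\<close> already forces \<open>x = proj y\<close>.\<close>

lemma continuous_on_proj: "continuous_on {y. infdist y C \<le> r} proj"
proof (rule continuous_from_closed_graph[OF compact_C])
  show "proj \<in> {y. infdist y C \<le> r} \<rightarrow> C"
    by (simp add: proj_in)
  have "(\<lambda>y. (y, proj y)) ` {y. infdist y C \<le> r} =
      {z. infdist (fst z) C \<le> r} \<inter> (UNIV \<times> C) \<inter> {z. dist (fst z) (snd z) \<le> infdist (fst z) C}"
    by (auto simp: proj_in dist_proj image_iff proj_unique)
  also have "closed \<dots>"
    by (intro closed_Int closed_Collect_le closed_Times closed_UNIV closed_C continuous_intros)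
  finally show "closed ((\<lambda>y. (y, proj y)) ` {y. infdist y C \<le> r})" .
qed

text \<open>A fixed point \<open>z\<close> of \<open>z \<mapsto> x + \<rho> (x - proj z) / |x - proj z|\<close> lies beyond \<open>x\<close> on the ray
  from \<open>proj z\<close> through \<open>x\<close>, so \<open>proj z\<close> is also the nearest point of \<open>x\<close>.\<close>

lemma extend_normal:
  assumes \<rho>: "0 < \<rho>" "\<rho> < infdist x C" "infdist x C + \<rho> \<le> r"
  shows "infdist (x + (\<rho> / infdist x C) *\<^sub>R (x - proj x)) C = infdist x C + \<rho>"
proof -
  let ?t = "infdist x C"
  define F where "F z = x + (\<rho> / norm (x - proj z)) *\<^sub>R (x - proj z)" for z
  have sub: "cball x \<rho> \<subseteq> {y. infdist y C \<le> r}"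
  proof
    fix z assume "z \<in> cball x \<rho>"
    then show "z \<in> {y. infdist y C \<le> r}"
      using infdist_triangle[of z C x] \<rho> by (simp add: dist_commute)
  qed
  have ne: "x - proj z \<noteq> 0" for z
    using proj_in[of z] \<rho> infdist_zero[of x C] by auto
  obtain z where z: "z \<in> cball x \<rho>" "F z = z"
  proof (rule brouwer_ball[OF \<rho>(1), of x F])
    have "continuous_on (cball x \<rho>) proj"
      using continuous_on_proj sub by (rule continuous_on_subset)
    then show "continuous_on (cball x \<rho>) F"
      unfolding F_def using ne by (intro continuous_intros) auto
    show "F \<in> cball x \<rho> \<rightarrow> cball x \<rho>"
      using \<rho> ne by (auto simp: F_def dist_norm)
  qed auto
  let ?n = "norm (x - proj z)"
  have n: "?n > 0"
    using ne by simp
  have "z - proj z = (1 + \<rho> / ?n) *\<^sub>R (x - proj z)"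
    using z(2) by (simp add: F_def algebra_simps)
  then have "norm (z - proj z) = \<bar>1 + \<rho> / ?n\<bar> * ?n"
    by simp
  also have "\<dots> = ?n + \<rho>"
    using n \<rho> by (simp add: field_simps)
  finally have dz: "infdist z C = ?n + \<rho>"
    using dist_proj[of z] by (simp add: dist_norm)
  \<comment> \<open>As \<open>z\<close> is within \<open>\<rho>\<close> of \<open>x\<close>,
    cancelling \<open>\<rho>\<close> shows that \<open>proj z\<close> is a nearest point of
    \<open>x\<close>.\<close>
  have "infdist z C \<le> ?t + \<rho>"
    using infdist_triangle[of z C x] z(1) by (simp add: dist_commute)
  with dz have "dist x (proj z) \<le> ?t"
    by (simp add: dist_norm)
  then have eq: "proj x = proj z"
    using \<rho> by (intro proj_unique proj_in) auto
  then have "?n = ?t"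
    using dist_proj[of x] by (simp add: dist_norm)
  with z(2) eq dz show ?thesis
    by (simp add: F_def)
qed

text \<open>The parameters between \<open>infdist x C\<close> and \<open>r\<close> at which the ray
  point still has its parameter as distance from \<open>C\<close> form a compact set. A maximum
  below \<open>r\<close> could be enlarged by \<open>extend_normal\<close>.\<close>

lemma normal_ray:
  assumes t: "0 < infdist x C" "infdist x C \<le> r"
  shows "infdist (proj x + (r / infdist x C) *\<^sub>R (x - proj x)) C = r"
proof -
  let ?t = "infdist x C"
  define u where "u = (x - proj x) /\<^sub>R ?t"
  have nu: "norm u = 1"
    using dist_proj[of x] t by (simp add: u_def dist_norm)
  have xu: "x = proj x + ?t *\<^sub>R u"
    using t by (simp add: u_def)
  define A where "A = {?t..r} \<inter> {s. infdist (proj x + s *\<^sub>R u) C = s}"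
  have "closed A"
    unfolding A_def by (intro closed_Int closed_atLeastAtMost closed_Collect_eq continuous_intros)
  then have "compact A"
    using bounded_subset[of "{?t..r}" A] by (auto simp: A_def compact_eq_bounded_closed)
  moreover have "?t \<in> A"
    using xu t by (auto simp: A_def)
  ultimately obtain s where s: "s \<in> A" "\<And>s'. s' \<in> A \<Longrightarrow> s' \<le> s"
    using compact_attains_sup[of A] by auto
  have "s = r"
  proof (rule ccontr)
    assume "s \<noteq> r"
    \<comment> \<open>\<open>s / 2\<close> keeps \<open>\<rho>\<close> below \<open>s\<close>, and
      \<open>r - s\<close> keeps the extended distance within \<open>r\<close>, as
      \<open>extend_normal\<close> demands.\<close>
    define \<rho> where "\<rho> = min (s / 2) (r - s)"
    define y where "y = proj x + s *\<^sub>R u"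
    have y: "infdist y C = s" "?t \<le> s" "s < r"
      using s \<open>s \<noteq> r\<close> by (auto simp: A_def y_def)
    have \<rho>: "0 < \<rho>" "\<rho> < s" "s + \<rho> \<le> r"
      using t y by (auto simp: \<rho>_def)
    have "proj y = proj x"
      using y nu t by (intro proj_unique proj_in) (auto simp: y_def dist_norm)
    moreover have "infdist (y + (\<rho> / s) *\<^sub>R (y - proj y)) C = s + \<rho>"
      using extend_normal[of \<rho> y] y \<rho> by simp
    ultimately have "infdist (proj x + (s + \<rho>) *\<^sub>R u) C = s + \<rho>"
      using t y by (simp add: y_def algebra_simps)
    then have "s + \<rho> \<in> A"
      using \<rho> y by (auto simp: A_def)
    with s(2) \<rho> show False
      by force
  qed
  with s(1) show ?thesis
    by (simp add: A_def u_def divide_inverse)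
qed

text \<open>The open ball of radius \<open>r\<close> around the point at distance \<open>r\<close>
  on the normal ray contains no point of \<open>C\<close>. Expanding the squared distance from its
  centre to \<open>a\<close> gives Federer's inequality; distance at most \<open>r / 2\<close> gives
  the factor \<open>1 / 4\<close>.\<close>

lemma inner_normal_le:
  assumes x: "infdist x C \<le> r / 2" and a: "a \<in> C"
  shows "(x - proj x) \<bullet> (a - proj x) \<le> (dist a (proj x))\<^sup>2 / 4"
proof (cases "infdist x C = 0")
  case True
  then show ?thesis
    using dist_proj[of x] by simp
next
  case False
  let ?t = "infdist x C" and ?p = "proj x"
  have t: "0 < ?t"
    using False infdist_nonneg[of x C] by simp
  define v where "v = (r / ?t) *\<^sub>R (x - ?p)"
  have nv: "norm v = r"
    using dist_proj[of x] t r_pos by (simp add: v_def dist_norm)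
  have "r \<le> norm (v - (a - ?p))"
    using normal_ray[of x] infdist_le[OF a, of "?p + v"] t x r_pos
    by (simp add: v_def dist_norm algebra_simps)
  then have "r\<^sup>2 \<le> (norm (v - (a - ?p)))\<^sup>2"
    using r_pos by (intro power_mono) auto
  also have "\<dots> = r\<^sup>2 - 2 * (v \<bullet> (a - ?p)) + (dist a ?p)\<^sup>2"
    by (simp add: power2_norm_eq_inner inner_diff dist_norm inner_commute flip: nv)
  finally have "2 * (r / ?t) * ((x - ?p) \<bullet> (a - ?p)) \<le> (dist a ?p)\<^sup>2"
    by (simp add: v_def)
  then have "(x - ?p) \<bullet> (a - ?p) \<le> ?t / (2 * r) * (dist a ?p)\<^sup>2"
    using t r_pos by (simp add: field_simps)
  also have "\<dots> \<le> 1 / 4 * (dist a ?p)\<^sup>2"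
    using x t r_pos by (intro mult_right_mono) (auto simp: field_simps)
  finally show ?thesis
    by simp
qed

text \<open>With \<open>d = proj y - proj x\<close>, the estimate \<open>inner_normal_le\<close> at
  \<open>x\<close> and at \<open>y\<close> gives
  \<open>|d|^2 \<le> |y - x| |d| + |d|^2 / 2\<close>.\<close>

lemma proj_lipschitz: "2-lipschitz_on {y. infdist y C \<le> r / 2} proj"
proof (rule lipschitz_onI)
  fix x y assume "x \<in> {y. infdist y C \<le> r / 2}" "y \<in> {y. infdist y C \<le> r / 2}"
  then have xy: "infdist x C \<le> r / 2" "infdist y C \<le> r / 2"
    by auto
  let ?d = "proj y - proj x"
  have 1: "(x - proj x) \<bullet> ?d \<le> (norm ?d)\<^sup>2 / 4"
    using inner_normal_le[OF xy(1) proj_in, of y] by (simp add: dist_norm)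
  have 2: "- ((y - proj y) \<bullet> ?d) \<le> (norm ?d)\<^sup>2 / 4"
    using inner_normal_le[OF xy(2) proj_in, of x]
    by (simp add: dist_norm norm_minus_commute inner_diff)
  have "(norm ?d)\<^sup>2 = ?d \<bullet> ?d"
    by (rule power2_norm_eq_inner)
  also have "\<dots> = (y - x) \<bullet> ?d + (x - proj x) \<bullet> ?d - (y - proj y) \<bullet> ?d"
    by (simp add: inner_diff)
  also have "(y - x) \<bullet> ?d \<le> norm (y - x) * norm ?d"
    by (rule norm_cauchy_schwarz)
  finally have "norm ?d * norm ?d \<le> (2 * norm (y - x)) * norm ?d"
    using 1 2 by (simp add: power2_eq_square)
  then have "norm ?d \<le> 2 * norm (y - x)"
    by (cases "?d = 0") auto
  then show "dist (proj x) (proj y) \<le> 2 * dist x y"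
    by (simp add: dist_norm norm_minus_commute)
qed simp

end

section \<open>Points joined by Lipschitz paths\<close>

text \<open>Speed at most 1 makes the travel time an upper bound for the length, so bounds add under
  concatenation and can be increased by pausing.\<close>

definition lip_joined :: "'a::metric_space set \<Rightarrow> real \<Rightarrow> 'a \<Rightarrow> 'a \<Rightarrow> bool" where
  "lip_joined S L x y \<longleftrightarrow>
     0 \<le> L \<and> (\<exists>g. 1-lipschitz_on {0..L} g \<and> g ` {0..L} \<subseteq> S \<and> g 0 = x \<and> g L = y)"

lemma lip_joined_refl:
  assumes "x \<in> S" "0 \<le> L"
  shows "lip_joined S L x x"
  unfolding lip_joined_def using assms
  by (auto intro!: exI[of _ "\<lambda>_. x"] lipschitz_on_le[OF lipschitz_on_constant])

lemma lip_joined_trans: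
  assumes "lip_joined S K x y" "lip_joined S L y z"
  shows "lip_joined S (K + L) x z"
proof -
  obtain f where f: "0 \<le> K" "1-lipschitz_on {0..K} f" "f ` {0..K} \<subseteq> S" "f 0 = x" "f K = y"
    using assms(1) by (auto simp: lip_joined_def)
  obtain g where g: "0 \<le> L" "1-lipschitz_on {0..L} g" "g ` {0..L} \<subseteq> S" "g 0 = y" "g L = z"
    using assms(2) by (auto simp: lip_joined_def)
  define h where "h t = (if t \<le> K then f t else g (t - K))" for t
  have "1-lipschitz_on {K..K + L} (\<lambda>t. g (t - K))"
  proof (rule lipschitz_onI)
    fix s t assume "s \<in> {K..K + L}" "t \<in> {K..K + L}"
    then show "dist (g (s - K)) (g (t - K)) \<le> 1 * dist s t"
      using lipschitz_onD[OF g(2), of "s - K" "t - K"] by (simp add: dist_real_def)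
  qed simp
  then have "1-lipschitz_on {0..K + L} h"
    unfolding h_def using f g by (intro lipschitz_on_concat) auto
  moreover have "h ` {0..K + L} \<subseteq> S" "h 0 = x"
    using f(1,3,4) g(3) by (auto simp: h_def image_subset_iff)
  \<comment> \<open>For \<open>L = 0\<close> the endpoint falls into the first branch of
    \<open>h\<close>, where \<open>f K = y = z\<close>.\<close>
  moreover have "h (K + L) = z"
    using f g by (cases "L = 0") (auto simp: h_def)
  ultimately show ?thesis
    unfolding lip_joined_def using f(1) g(1) by auto
qed

lemma lip_joined_in:
  assumes "lip_joined S L x y"
  shows "x \<in> S" "y \<in> S"
  using assms by (force simp: lip_joined_def)+

lemma lip_joined_mono:
  assumes "lip_joined S K x y" "K \<le> L"
  shows "lip_joined S L x y"
  using lip_joined_trans[OF assms(1) lip_joined_refl[of y S "L - K"]] lip_joined_in(2)[OF assms(1)] assms(2)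
  by simp

lemma lip_joined_relpow:
  assumes "(x, y) \<in> E ^^ n" "\<And>u v. (u, v) \<in> E \<Longrightarrow> lip_joined S L u v" "x \<in> S"
  shows "lip_joined S (real n * L) x y"
  using assms(1)
proof (induction n arbitrary: y)
  case 0
  then show ?case
    using assms(3) by (simp add: lip_joined_refl)
next
  case (Suc n)
  then obtain z where "(x, z) \<in> E ^^ n" "(z, y) \<in> E"
    by auto
  then have "lip_joined S (real n * L + L) x y"
    using Suc.IH assms(2) lip_joined_trans by blast
  then show ?case
    by (simp add: algebra_simps)
qed

lemma lip_joined_connected:
  assumes "lip_joined S L x y"
  obtains K where "connected K" "K \<subseteq> S" "x \<in> K" "y \<in> K"
proof -
  obtain g where g: "0 \<le> L" "1-lipschitz_on {0..L} g" "g ` {0..L} \<subseteq> S" "g 0 = x" "g L = y"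
    using assms by (auto simp: lip_joined_def)
  have "connected (g ` {0..L})"
    using lipschitz_on_continuous_on[OF g(2)] by (intro connected_continuous_image) auto
  with g show ?thesis
    by (intro that[of "g ` {0..L}"]) auto
qed

text \<open>The segment is traversed in time \<open>2 * r\<close>, hence at speed at most
  \<open>1 / 2\<close>, and each of its points is within \<open>r / 2\<close> of an endpoint.
  Projecting it to \<open>C\<close> at most doubles the speed.\<close>

lemma (in tubular_nbhd) lip_joined_near:
  assumes "x \<in> C" "y \<in> C" "dist x y \<le> r"
  shows "lip_joined C (2 * r) x y"
proof -
  define l where "l t = x + (t / (2 * r)) *\<^sub>R (y - x)" for t :: real
  have l_near: "infdist (l t) C \<le> r / 2" if t: "t \<in> {0..2 * r}" for t
  proof (cases "t \<le> r")
    case True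
    have "dist (l t) x = t / (2 * r) * dist x y"
      using t r_pos by (simp add: l_def dist_norm norm_minus_commute)
    also have "\<dots> \<le> 1 / 2 * r"
      using t True r_pos assms(3) by (intro mult_mono) (auto simp: field_simps)
    finally show ?thesis
      using infdist_le[OF assms(1), of "l t"] by simp
  next
    case False
    have "l t - y = (1 - t / (2 * r)) *\<^sub>R (x - y)"
      by (simp add: l_def algebra_simps)
    then have "dist (l t) y = (1 - t / (2 * r)) * dist x y"
      using t r_pos by (simp add: dist_norm)
    also have "\<dots> \<le> 1 / 2 * r"
      using t False r_pos assms(3) by (intro mult_mono) (auto simp: field_simps)
    finally show ?thesis
      using infdist_le[OF assms(2), of "l t"] by simp
  qed
  have "dist (proj (l s)) (proj (l t)) \<le> 1 * dist s t" if "s \<in> {0..2 * r}" "t \<in> {0..2 * r}" for s t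
  proof -
    have "dist (proj (l s)) (proj (l t)) \<le> 2 * dist (l s) (l t)"
      using lipschitz_onD[OF proj_lipschitz] l_near that by simp
    also have "l s - l t = ((s - t) / (2 * r)) *\<^sub>R (y - x)"
      by (simp add: l_def algebra_simps diff_divide_distrib)
    then have "2 * dist (l s) (l t) = dist s t * (dist x y / r)"
      using r_pos by (simp add: dist_norm norm_minus_commute)
    also have "\<dots> \<le> dist s t * 1"
      using assms(3) r_pos by (intro mult_left_mono) auto
    finally show ?thesis
      by simp
  qed
  then have "1-lipschitz_on {0..2 * r} (proj \<circ> l)"
    by (intro lipschitz_onI) auto
  moreover have "(proj \<circ> l) 0 = x" "(proj \<circ> l) (2 * r) = y"
    using r_pos assms by (auto simp: l_def closest_point_self)
  ultimately show ?thesis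
    unfolding lip_joined_def using r_pos proj_in by (auto intro!: exI[of _ "proj \<circ> l"])
qed

section \<open>Chains through a finite cover\<close>

text \<open>One cover of the ball of radius \<open>\<delta>\<close> by balls of radius
  \<open>\<epsilon> / 2\<close> fixes \<open>N\<close> and serves every translate
  \<open>S - x\<close> with \<open>x\<close> in \<open>S\<close>. Replacing each centre whose ball
  meets the translate by a point of \<open>S\<close> doubles the radius.\<close>

lemma diameter_cover_bound:
  fixes \<delta> \<epsilon> :: real
  assumes "0 < \<epsilon>"
  shows "\<exists>N. \<forall>S :: 'a::euclidean_space set. bounded S \<longrightarrow> diameter S \<le> \<delta> \<longrightarrow>
    (\<exists>F. finite F \<and> card F \<le> N \<and> F \<subseteq> S \<and> S \<subseteq> (\<Union>c\<in>F. ball c \<epsilon>))"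
proof -
  obtain K where K: "finite K" "cball (0::'a) \<delta> \<subseteq> (\<Union>k\<in>K. ball k (\<epsilon> / 2))"
    by (rule compactE_image[OF compact_cball, of "cball 0 \<delta>" "\<lambda>k. ball k (\<epsilon> / 2)"])
      (use assms in auto)
  show ?thesis
  proof (intro exI[of _ "card K"] allI impI)
    fix S :: "'a set" assume S: "bounded S" "diameter S \<le> \<delta>"
    show "\<exists>F. finite F \<and> card F \<le> card K \<and> F \<subseteq> S \<and> S \<subseteq> (\<Union>c\<in>F. ball c \<epsilon>)"
    proof (cases "S = {}")
      case False
      then obtain x where x: "x \<in> S"
        by auto
      define K' where "K' = {k \<in> K. \<exists>s\<in>S. dist (s - x) k < \<epsilon> / 2}"
      have "\<forall>k\<in>K'. \<exists>s. s \<in> S \<and> dist (s - x) k < \<epsilon> / 2"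
        by (auto simp: K'_def)
      from bchoice[OF this] obtain c where c: "\<And>k. k \<in> K' \<Longrightarrow> c k \<in> S \<and> dist (c k - x) k < \<epsilon> / 2"
        by blast
      have "S \<subseteq> (\<Union>k\<in>c ` K'. ball k \<epsilon>)"
      proof
        fix s assume s: "s \<in> S"
        have "s - x \<in> cball 0 \<delta>"
          using diameter_bounded_bound[OF S(1) s x] S(2)
          by (simp add: dist_norm norm_minus_commute)
        then obtain k where k: "k \<in> K" "dist k (s - x) < \<epsilon> / 2"
          using K(2) by auto
        then have "k \<in> K'"
          using s by (auto simp: K'_def dist_commute)
        moreover have "dist (c k) s = dist (c k - x) (s - x)"
          by (simp add: dist_norm)
        then have "dist (c k) s < \<epsilon>"
          using c[OF \<open>k \<in> K'\<close>] k(2) dist_triangle_half_l[of "c k - x" k \<epsilon> "s - x"]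
          by (simp add: dist_commute)
        ultimately show "s \<in> (\<Union>k\<in>c ` K'. ball k \<epsilon>)"
          by auto
      qed
      moreover have "K' \<subseteq> K"
        by (auto simp: K'_def)
      moreover from this have "finite K'"
        using K(1) by (rule finite_subset)
      moreover from this have "card (c ` K') \<le> card K"
        using card_image_le[of K' c] card_mono[OF K(1) \<open>K' \<subseteq> K\<close>] by linarith
      moreover have "c ` K' \<subseteq> S"
        using c by auto
      ultimately show ?thesis
        by blast
    qed (auto intro: exI[of _ "{}"])
  qed
qed

text \<open>Otherwise the balls around centres reachable from \<open>a\<close> and those around the
  other centres would disconnect \<open>S\<close>: overlapping balls have centres closer than
  \<open>\<epsilon>\<close>.\<close>

lemma connected_cover_chain:
  fixes S :: "'a::metric_space set"
  assumes "connected S" "F \<subseteq> S" "S \<subseteq> (\<Union>c\<in>F. ball c (\<epsilon> / 2))" "a \<in> F" "b \<in> F"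
  shows "(a, b) \<in> {(u, v) \<in> F \<times> F. dist u v < \<epsilon>}\<^sup>*"
proof (rule ccontr)
  let ?E = "{(u, v) \<in> F \<times> F. dist u v < \<epsilon>}"
  assume "(a, b) \<notin> ?E\<^sup>*"
  define A where "A = {c \<in> F. (a, c) \<in> ?E\<^sup>*}"
  let ?U = "\<Union>c\<in>A. ball c (\<epsilon> / 2)" and ?V = "\<Union>c\<in>F - A. ball c (\<epsilon> / 2)"
  have "\<epsilon> > 0"
  proof -
    have "a \<in> (\<Union>c\<in>F. ball c (\<epsilon> / 2))"
      using assms(2-4) by (blast del: UN_E)
    then obtain c where "dist c a < \<epsilon> / 2"
      by auto
    then show ?thesis
      using zero_le_dist[of c a] by linarith
  qed
  have "?U \<inter> ?V = {}"
  proof (rule ccontr)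
    assume "?U \<inter> ?V \<noteq> {}"
    then obtain z where "z \<in> ?U" "z \<in> ?V"
      by blast
    then obtain u v where uv: "u \<in> A" "v \<in> F - A" "dist u z < \<epsilon> / 2" "dist v z < \<epsilon> / 2"
      by (auto simp del: Diff_iff)
    then have "(u, v) \<in> ?E"
      using dist_triangle_half_l[of u z \<epsilon> v] by (auto simp: A_def)
    with uv show False
      unfolding A_def by (auto intro: rtrancl_into_rtrancl)
  qed
  moreover have "S \<subseteq> ?U \<union> ?V"
    using assms(3) by auto
  ultimately have "?U \<inter> S = {} \<or> ?V \<inter> S = {}"
    using connectedD[OF assms(1), of ?U ?V] by blast
  moreover have "a \<in> ?U \<inter> S"
    using assms(2,4) \<open>\<epsilon> > 0\<close> by (auto simp: A_def)
  moreover have "b \<in> ?V \<inter> S"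
    using assms(2,5) \<open>\<epsilon> > 0\<close> \<open>(a, b) \<notin> ?E\<^sup>*\<close>
    by (auto simp: A_def intro!: bexI[of _ b])
  ultimately show False
    by blast
qed

text \<open>A chain of centres leads from one near \<open>x\<close> to one near \<open>y\<close>,
  and each link costs \<open>2 * r\<close> by \<open>lip_joined_near\<close>. The links at the two
  ends account for the summand \<open>2\<close>.\<close>

lemma (in tubular_nbhd) lip_joined_cover:
  assumes S: "connected S" "S \<subseteq> C" and F: "finite F" "card F \<le> N" "F \<subseteq> S" "S \<subseteq> (\<Union>c\<in>F. ball c (r / 2))"
    and xy: "x \<in> S" "y \<in> S"
  shows "lip_joined C (real (N * N + 2) * (2 * r)) x y"
proof -
  let ?E = "{(u, v) \<in> F \<times> F. dist u v < r}"
  have "x \<in> (\<Union>c\<in>F. ball c (r / 2))" "y \<in> (\<Union>c\<in>F. ball c (r / 2))"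
    using F(4) xy by (simp_all only: subsetD)
  then obtain a b where ab: "a \<in> F" "dist a x < r / 2" "b \<in> F" "dist b y < r / 2"
    by auto
  have fin: "finite ?E"
    using F(1) by (auto intro: finite_subset[of _ "F \<times> F"])
  have "card ?E \<le> card F * card F"
    using card_mono[of "F \<times> F" ?E] F(1) by (auto simp: card_cartesian_product)
  also have "\<dots> \<le> N * N"
    using F(2) by (intro mult_mono) auto
  finally have card: "card ?E \<le> N * N" .
  \<comment> \<open>A finite relation needs at most as many steps as it has pairs, whence
    \<open>N * N\<close>.\<close>
  obtain n where n: "n \<le> card ?E" "(a, b) \<in> ?E ^^ n"
    using connected_cover_chain[OF S(1) F(3,4) ab(1,3)] rtrancl_finite_eq_relpow[OF fin] by auto
  have "lip_joined C (real n * (2 * r)) a b"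
    using n(2) by (rule lip_joined_relpow) (use F(3) S(2) ab in \<open>auto intro!: lip_joined_near\<close>)
  moreover have "lip_joined C (2 * r) x a" "lip_joined C (2 * r) b y"
    using ab F(3) S(2) xy r_pos by (auto intro!: lip_joined_near simp: dist_commute)
  ultimately have "lip_joined C (2 * r + real n * (2 * r) + 2 * r) x y"
    by (meson lip_joined_trans)
  moreover have "real n * (2 * r) \<le> real (N * N) * (2 * r)"
    using n(1) card r_pos by (intro mult_right_mono) (auto simp del: of_nat_mult)
  ultimately show ?thesis
    by (elim lip_joined_mono) (simp add: algebra_simps)
qed

section \<open>Arc length\<close>

lemma arc_length_ge:
  assumes "mono_on {..n} t" "t ` {..n} \<subseteq> {a..b}"
  shows "ennreal (\<Sum>i<n. dist (\<gamma> (t i)) (\<gamma> (t (Suc i)))) \<le> arc_length \<gamma> a b"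
  unfolding arc_length_def using assms by (intro SUP_upper2[of "(n, t)"]) auto

lemma arc_length_leI:
  assumes "\<And>n t. mono_on {..n} t \<Longrightarrow> t ` {..n} \<subseteq> {a..b} \<Longrightarrow>
    ennreal (\<Sum>i<n. dist (\<gamma> (t i)) (\<gamma> (t (Suc i)))) \<le> L"
  shows "arc_length \<gamma> a b \<le> L"
  unfolding arc_length_def using assms by (intro SUP_least) auto

lemma arc_length_add_leI:
  assumes "a \<le> b" "\<And>n t. mono_on {..n} t \<Longrightarrow> t ` {..n} \<subseteq> {a..b} \<Longrightarrow>
    ennreal (\<Sum>i<n. dist (\<gamma> (t i)) (\<gamma> (t (Suc i)))) + c \<le> L"
  shows "arc_length \<gamma> a b + c \<le> L"
proof -
  let ?P = "{(n::nat, t). mono_on {..n} t \<and> t ` {..n} \<subseteq> {a..b}}"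
  \<comment> \<open>Moving \<open>c\<close> under the supremum requires a nonempty family; the
    one-vertex polygon supplies a member.\<close>
  have "(0, \<lambda>_. a) \<in> ?P"
    using assms(1) by (auto intro: mono_onI)
  then have "?P \<noteq> {}"
    by blast
  then show ?thesis
    unfolding arc_length_def using assms(2)
    by (subst ennreal_SUP_add_left[symmetric]) (auto intro!: SUP_least)
qed

lemma arc_length_mono:
  assumes "a' \<le> a" "b \<le> b'"
  shows "arc_length \<gamma> a b \<le> arc_length \<gamma> a' b'"
  by (rule arc_length_leI) (use assms in \<open>force intro: arc_length_ge\<close>)

lemma arc_length_refl [simp]: "arc_length \<gamma> a a = 0"
proof -
  have "arc_length \<gamma> a a \<le> 0"
  proof (rule arc_length_leI)
    fix n :: nat and t :: "nat \<Rightarrow> real" assume "t ` {..n} \<subseteq> {a..a}"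
    then have "t i = a" if "i \<le> n" for i
      using that by auto
    then show "ennreal (\<Sum>i<n. dist (\<gamma> (t i)) (\<gamma> (t (Suc i)))) \<le> 0"
      by simp
  qed
  then show ?thesis
    by simp
qed

lemma dist_le_arc_length:
  assumes "a \<le> b"
  shows "ennreal (dist (\<gamma> a) (\<gamma> b)) \<le> arc_length \<gamma> a b"
proof -
  have "mono_on {..1} (\<lambda>i::nat. if i = 0 then a else b)"
    using assms by (auto intro!: mono_onI)
  from arc_length_ge[OF this, of a b \<gamma>] show ?thesis
    using assms by (auto simp: image_subset_iff)
qed

lemma arc_length_lipschitz:
  assumes g: "L-lipschitz_on {a..b} \<gamma>" and "a \<le> b"
  shows "arc_length \<gamma> a b \<le> ennreal (L * (b - a))"
proof (rule arc_length_leI)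
  fix n :: nat and t :: "nat \<Rightarrow> real" assume t: "mono_on {..n} t" "t ` {..n} \<subseteq> {a..b}"
  have "(\<Sum>i<n. dist (\<gamma> (t i)) (\<gamma> (t (Suc i)))) \<le> (\<Sum>i<n. L * (t (Suc i) - t i))"
  proof (rule sum_mono)
    fix i assume i: "i \<in> {..<n}"
    have "dist (\<gamma> (t i)) (\<gamma> (t (Suc i))) \<le> L * dist (t i) (t (Suc i))"
      using i t(2) by (intro lipschitz_onD[OF g]) (auto simp: image_subset_iff)
    moreover have "t i \<le> t (Suc i)"
      using i t(1) by (auto intro: mono_onD)
    ultimately show "dist (\<gamma> (t i)) (\<gamma> (t (Suc i))) \<le> L * (t (Suc i) - t i)"
      by (simp add: dist_real_def)
  qed
  also have "\<dots> = L * (t n - t 0)"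
    by (simp add: sum_lessThan_telescope flip: sum_distrib_left)
  also have "t n \<in> {a..b}" "t 0 \<in> {a..b}"
    using t(2) by auto
  then have "L * (t n - t 0) \<le> L * (b - a)"
    using lipschitz_on_nonneg[OF g] by (intro mult_left_mono) auto
  finally show "ennreal (\<Sum>i<n. dist (\<gamma> (t i)) (\<gamma> (t (Suc i)))) \<le> ennreal (L * (b - a))"
    by (rule ennreal_leI)
qed

text \<open>Clamping the vertices at \<open>c\<close> splits a polygon without reindexing it: an
  edge across \<open>c\<close> is bounded by the detour through \<open>\<gamma> c\<close>, and any
  other edge survives in one of the two sums.\<close>

lemma polygon_length_split:
  fixes t :: "nat \<Rightarrow> real"
  shows "(\<Sum>i<n. dist (\<gamma> (t i)) (\<gamma> (t (Suc i)))) \<le>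
    (\<Sum>i<n. dist (\<gamma> (min c (t i))) (\<gamma> (min c (t (Suc i))))) +
    (\<Sum>i<n. dist (\<gamma> (max c (t i))) (\<gamma> (max c (t (Suc i)))))"
proof -
  have "dist (\<gamma> u) (\<gamma> v) \<le>
      dist (\<gamma> (min c u)) (\<gamma> (min c v)) + dist (\<gamma> (max c u)) (\<gamma> (max c v))" for u v
    using dist_triangle[of "\<gamma> u" "\<gamma> v" "\<gamma> c"]
    by (cases "u \<le> c"; cases "v \<le> c") (auto simp: min_def max_def add.commute)
  then show ?thesis
    by (simp add: sum_mono flip: sum.distrib)
qed

lemma mono_on_min_max:
  fixes t :: "nat \<Rightarrow> real"
  assumes "mono_on A t"
  shows "mono_on A (\<lambda>i. min c (t i))" "mono_on A (\<lambda>i. max c (t i))"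
  using assms unfolding mono_on_def by (meson max.mono min.mono order_refl)+

lemma arc_length_subadd:
  assumes "a \<le> b" "b \<le> c"
  shows "arc_length \<gamma> a c \<le> arc_length \<gamma> a b + arc_length \<gamma> b c"
proof (rule arc_length_leI)
  fix n :: nat and t :: "nat \<Rightarrow> real" assume t: "mono_on {..n} t" "t ` {..n} \<subseteq> {a..c}"
  have "ennreal (\<Sum>i<n. dist (\<gamma> (t i)) (\<gamma> (t (Suc i)))) \<le>
      ennreal (\<Sum>i<n. dist (\<gamma> (min b (t i))) (\<gamma> (min b (t (Suc i))))) +
      ennreal (\<Sum>i<n. dist (\<gamma> (max b (t i))) (\<gamma> (max b (t (Suc i)))))"
    using polygon_length_split[of \<gamma> t n b]
    by (subst ennreal_plus[symmetric]) (auto intro!: sum_nonneg ennreal_leI)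
  also have "\<dots> \<le> arc_length \<gamma> a b + arc_length \<gamma> b c"
    using mono_on_min_max[OF t(1), of b] t(2) assms
    by (intro add_mono arc_length_ge) auto
  finally show "ennreal (\<Sum>i<n. dist (\<gamma> (t i)) (\<gamma> (t (Suc i)))) \<le> \<dots>" .
qed

text \<open>Polygons on the two intervals are concatenated; the edge joining them only adds
  length.\<close>

lemma arc_length_superadd:
  assumes "a \<le> b" "b \<le> c"
  shows "arc_length \<gamma> a b + arc_length \<gamma> b c \<le> arc_length \<gamma> a c"
proof -
  have "ennreal (\<Sum>i<n. dist (\<gamma> (s i)) (\<gamma> (s (Suc i)))) + ennreal (\<Sum>i<m. dist (\<gamma> (t i)) (\<gamma> (t (Suc i))))
      \<le> arc_length \<gamma> a c"
    if s: "mono_on {..n} s" "s ` {..n} \<subseteq> {a..b}" and t: "mono_on {..m} t" "t ` {..m} \<subseteq> {b..c}"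
    for n m :: nat and s t :: "nat \<Rightarrow> real"
  proof -
    \<comment> \<open>The \<open>n + 1\<close> vertices of \<open>s\<close> precede the
      \<open>m + 1\<close> vertices of \<open>t\<close>, giving \<open>Suc n + m\<close> edges; edge
      \<open>n\<close> is the joining one.\<close>
    define u where "u i = (if i \<le> n then s i else t (i - Suc n))" for i
    let ?d = "\<lambda>i. dist (\<gamma> (u i)) (\<gamma> (u (Suc i)))"
    have "mono_on {..Suc n + m} u"
    proof (rule mono_onI)
      fix i j assume ij: "i \<in> {..Suc n + m}" "j \<in> {..Suc n + m}" "i \<le> j"
      consider "j \<le> n" | "i \<le> n" "n < j" | "n < i"
        by linarith
      then show "u i \<le> u j"
      proof cases
        case 1
        then show ?thesis
          using ij s(1) by (auto simp: u_def mono_on_def)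
      next
        case 2
        then have "i \<in> {..n}" "j - Suc n \<in> {..m}"
          using ij by auto
        then have "s i \<le> b" "b \<le> t (j - Suc n)"
          using s(2) t(2) by (auto simp: image_subset_iff)
        then show ?thesis
          using 2 by (simp add: u_def)
      next
        case 3
        then have "i - Suc n \<in> {..m}" "j - Suc n \<in> {..m}" "i - Suc n \<le> j - Suc n"
          using ij by auto
        with t(1) have "t (i - Suc n) \<le> t (j - Suc n)"
          by (rule mono_onD)
        then show ?thesis
          using 3 ij by (simp add: u_def)
      qed
    qed
    moreover have "u i \<in> {a..c}" if "i \<le> Suc n + m" for i
    proof (cases "i \<le> n")
      case True
      then have "s i \<in> {a..b}"
        using s(2) by auto
      then show ?thesis
        using True assms by (simp add: u_def)
    next
      case False
      then have "i - Suc n \<le> m"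
        using that by simp
      then have "t (i - Suc n) \<in> {b..c}"
        using t(2) by auto
      then show ?thesis
        using False assms by (simp add: u_def)
    qed
    ultimately have "ennreal (\<Sum>i<Suc n + m. ?d i) \<le> arc_length \<gamma> a c"
      by (intro arc_length_ge) auto
    moreover have "(\<Sum>i<Suc n + m. ?d i) = (\<Sum>i<Suc n. ?d i) + (\<Sum>i<m. ?d (Suc n + i))"
      by (induction m) (auto simp: algebra_simps)
    moreover have "(\<Sum>i<n. ?d i) \<le> (\<Sum>i<Suc n. ?d i)"
      by simp
    moreover have "(\<Sum>i<n. ?d i) = (\<Sum>i<n. dist (\<gamma> (s i)) (\<gamma> (s (Suc i))))"
      "(\<Sum>i<m. ?d (Suc n + i)) = (\<Sum>i<m. dist (\<gamma> (t i)) (\<gamma> (t (Suc i))))"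
      by (auto simp: u_def intro!: sum.cong)
    ultimately show ?thesis
      by (subst ennreal_plus[symmetric])
        (auto intro!: sum_nonneg elim!: order_trans[rotated] intro!: ennreal_leI)
  qed note * = this
  show ?thesis
  proof (rule arc_length_add_leI[OF assms(1)])
    fix n :: nat and s :: "nat \<Rightarrow> real" assume s: "mono_on {..n} s" "s ` {..n} \<subseteq> {a..b}"
    show "ennreal (\<Sum>i<n. dist (\<gamma> (s i)) (\<gamma> (s (Suc i)))) + arc_length \<gamma> b c \<le> arc_length \<gamma> a c"
      by (subst add.commute, rule arc_length_add_leI[OF assms(2)], subst add.commute) (rule *[OF s])
  qed
qed

text \<open>Only finitely many vertices of a nearly optimal polygon on \<open>[a, c]\<close> matter, so pushing \<open>b\<close>
  towards \<open>a\<close> leaves almost all of the length on \<open>[b, c]\<close>.\<close>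

lemma arc_length_tendsto_right:
  assumes g: "continuous_on {a..c} \<gamma>" and ac: "a < c" and fin: "arc_length \<gamma> a c < \<infinity>" and e: "0 < e"
  obtains \<delta> where "0 < \<delta>" "\<delta> \<le> c - a" "\<And>b. a \<le> b \<Longrightarrow> b < a + \<delta> \<Longrightarrow> arc_length \<gamma> a b \<le> ennreal e"
proof -
  let ?S = "\<lambda>n t. \<Sum>i<n. dist (\<gamma> (t i)) (\<gamma> (t (Suc i)))"
  obtain n t where nt: "mono_on {..n} t" "t ` {..n} \<subseteq> {a..c}"
    "arc_length \<gamma> a c \<le> ennreal (?S n t) + ennreal (e / 2)"
  \<comment> \<open>If every polygon fell short by more than \<open>e / 2\<close>, their supremum
    would fall short of itself by \<open>e / 2\<close>, impossible for a finite length.\<close>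
  proof (rule ccontr)
    assume contr: "\<not> thesis"
    have "arc_length \<gamma> a c + ennreal (e / 2) \<le> arc_length \<gamma> a c"
    proof (rule arc_length_add_leI)
      fix n :: nat and t :: "nat \<Rightarrow> real" assume "mono_on {..n} t" "t ` {..n} \<subseteq> {a..c}"
      then have "\<not> arc_length \<gamma> a c \<le> ennreal (?S n t) + ennreal (e / 2)"
        using that contr by blast
      then show "ennreal (?S n t) + ennreal (e / 2) \<le> arc_length \<gamma> a c"
        by simp
    qed (use ac in simp)
    with fin e show False
      by (cases "arc_length \<gamma> a c") (auto simp flip: ennreal_plus)
  qed
  \<comment> \<open>Each of the \<open>n\<close> edges clamped to \<open>[a, b]\<close> has length
    at most \<open>2 * \<eta>\<close>, in total at most \<open>e / 2\<close>; the \<open>+ 1\<close>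
    covers \<open>n = 0\<close>.\<close>
  define \<eta> where "\<eta> = e / (4 * (real n + 1))"
  have \<eta>: "0 < \<eta>" "real n * (2 * \<eta>) \<le> e / 2"
    using e by (auto simp: \<eta>_def field_simps)
  obtain d where d: "0 < d" "\<And>x. x \<in> {a..c} \<Longrightarrow> dist x a < d \<Longrightarrow> dist (\<gamma> x) (\<gamma> a) < \<eta>"
    using bspec[OF g[unfolded continuous_on_iff], of a] ac \<eta>(1) by auto
  show thesis
  proof (rule that[of "min d (c - a)"])
    fix b assume b: "a \<le> b" "b < a + min d (c - a)"
    have near: "dist (\<gamma> x) (\<gamma> a) < \<eta>" if "x \<in> {a..b}" for x
      using that b by (intro d(2)) (auto simp: dist_real_def)
    have m: "min b (t i) \<in> {a..b}" if "i \<le> n" for i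
      using nt(2) that b by (auto simp: image_subset_iff)
    have "?S n (\<lambda>i. min b (t i)) \<le> (\<Sum>i<n. 2 * \<eta>)"
    proof (rule sum_mono)
      fix i assume "i \<in> {..<n}"
      then show "dist (\<gamma> (min b (t i))) (\<gamma> (min b (t (Suc i)))) \<le> 2 * \<eta>"
        using near[OF m[of i]] near[OF m[of "Suc i"]]
          dist_triangle2[of "\<gamma> (min b (t i))" "\<gamma> (min b (t (Suc i)))" "\<gamma> a"] by simp
    qed
    also have "\<dots> \<le> e / 2"
      using \<eta>(2) by simp
    finally have "?S n t \<le> e / 2 + ?S n (\<lambda>i. max b (t i))"
      using polygon_length_split[of \<gamma> t n b] by linarith
    then have "ennreal (?S n t) \<le> ennreal (e / 2) + ennreal (?S n (\<lambda>i. max b (t i)))"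
      using e by (subst ennreal_plus[symmetric]) (auto intro!: sum_nonneg ennreal_leI)
    moreover have "ennreal (?S n (\<lambda>i. max b (t i))) \<le> arc_length \<gamma> b c"
      using mono_on_min_max(2)[OF nt(1), of b] nt(2) b by (intro arc_length_ge) (auto simp: image_subset_iff)
    ultimately have "ennreal (?S n t) \<le> ennreal (e / 2) + arc_length \<gamma> b c"
      using add_left_mono order_trans by blast
    from order_trans[OF nt(3) add_right_mono[OF this]]
    have "arc_length \<gamma> a c \<le> ennreal (e / 2) + arc_length \<gamma> b c + ennreal (e / 2)" .
    also have "\<dots> = (ennreal (e / 2) + ennreal (e / 2)) + arc_length \<gamma> b c"
      by (simp only: add_ac)
    also have "ennreal (e / 2) + ennreal (e / 2) = ennreal e"
      using e by (simp flip: ennreal_plus)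
    finally have "arc_length \<gamma> a c \<le> ennreal e + arc_length \<gamma> b c" .
    then have "arc_length \<gamma> a b + arc_length \<gamma> b c \<le> ennreal e + arc_length \<gamma> b c"
      using b by (intro order_trans[OF arc_length_superadd]) auto
    moreover have "arc_length \<gamma> b c < \<infinity>"
      using arc_length_mono[of a b c c \<gamma>] b fin by (auto elim: le_less_trans)
    ultimately show "arc_length \<gamma> a b \<le> ennreal e"
      by (auto simp: add.commute[of _ "arc_length \<gamma> b c"] ennreal_add_left_cancel_le)
  qed (use d ac in auto)
qed


text \<open>These properties let \<open>interval_measure\<close> give \<open>{a<..b}\<close> the
  mass \<open>s b - s a\<close>. On \<open>[0, 1)\<close> right continuity comes from
  \<open>arc_length_tendsto_right\<close>; elsewhere \<open>s\<close> is constant just to the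
  right.\<close>

lemma arc_length_param:
  assumes \<gamma>: "path \<gamma>" and fin: "arc_length \<gamma> 0 1 < \<infinity>"
  defines "s \<equiv> \<lambda>t. enn2real (arc_length \<gamma> 0 (max 0 (min 1 t)))"
  shows "mono s" "\<And>a. continuous (at_right a) s"
proof -
  have fin': "arc_length \<gamma> a b < \<infinity>" if "0 \<le> a" "b \<le> 1" for a b
    using arc_length_mono[OF that, of \<gamma>] fin by (rule le_less_trans)
  show mono: "mono s"
    unfolding s_def using fin' by (intro monoI enn2real_mono arc_length_mono) (auto simp: top.not_eq_extremum)
  fix a :: real
  show "continuous (at_right a) s"
  proof (cases "a < 0 \<or> 1 \<le> a")
    case True
    then have "eventually (\<lambda>t. s t = s a) (at_right a)"
    proof
      assume "a < 0"
      then show ?thesis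
        unfolding eventually_at_right_field by (intro exI[of _ 0]) (auto simp: s_def)
    next
      assume "1 \<le> a"
      then show ?thesis
        unfolding eventually_at_right_field by (intro exI[of _ "a + 1"]) (auto simp: s_def)
    qed
    then show ?thesis
      unfolding continuous_within by (rule tendsto_eventually)
  next
    case False
    then have a: "0 \<le> a" "a < 1"
      by auto
    show ?thesis
      unfolding continuous_within
    proof (rule tendstoI)
      fix e :: real assume "e > 0"
      have "continuous_on {a..1} \<gamma>"
        using \<gamma> a unfolding path_def by (auto intro: continuous_on_subset)
      from arc_length_tendsto_right[OF this a(2) fin'[OF a(1) order_refl] half_gt_zero[OF \<open>e > 0\<close>]]
      obtain \<delta> where \<delta>: "0 < \<delta>" "\<delta> \<le> 1 - a"
        "\<And>b. a \<le> b \<Longrightarrow> b < a + \<delta> \<Longrightarrow> arc_length \<gamma> a b \<le> ennreal (e / 2)"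
        by blast
      have "dist (s b) (s a) < e" if b: "a < b" "b < a + \<delta>" for b
      proof -
        have "arc_length \<gamma> 0 b \<le> arc_length \<gamma> 0 a + arc_length \<gamma> a b"
          using a b by (intro arc_length_subadd) auto
        also have "\<dots> \<le> ennreal (s a) + ennreal (e / 2)"
          using a b fin'[of 0 a] \<delta>(3)[of b] by (intro add_mono) (auto simp: s_def)
        also have "\<dots> = ennreal (s a + e / 2)"
          using \<open>e > 0\<close> by (simp add: s_def)
        finally have "s b \<le> s a + e / 2"
          using a b \<delta>(2) \<open>e > 0\<close> by (auto simp: s_def intro!: enn2real_leI)
        with monoD[OF mono, of a b] b \<open>e > 0\<close> show ?thesis
          by (simp add: dist_real_def)
      qed
      then show "eventually (\<lambda>b. dist (s b) (s a) < e) (at_right a)"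
        unfolding eventually_at_right_field using \<delta>(1) by (intro exI[of _ "a + \<delta>"]) auto
    qed
  qed
qed

section \<open>The arc length measure and integrals along paths\<close>

lemma emeasure_arc_measure_Ioc:
  assumes \<gamma>: "path \<gamma>" "arc_length \<gamma> 0 1 < \<infinity>" and ab: "a \<le> b"
  shows "emeasure (arc_measure \<gamma>) {a<..b} =
    ennreal (enn2real (arc_length \<gamma> 0 (max 0 (min 1 b))) - enn2real (arc_length \<gamma> 0 (max 0 (min 1 a))))"
  unfolding arc_measure_def
  by (rule emeasure_interval_measure_Ioc[OF ab]) (use arc_length_param[OF \<gamma>] in \<open>auto dest: monoD\<close>)

lemma sets_arc_measure [simp]: "sets (arc_measure \<gamma>) = sets borel"
  by (simp add: arc_measure_def)

lemma arc_integral_le: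
  assumes \<gamma>: "path \<gamma>" "arc_length \<gamma> 0 1 < \<infinity>" and w: "\<And>t. t \<in> {0..1} \<Longrightarrow> w (\<gamma> t) \<le> c"
  shows "arc_integral \<gamma> w \<le> c * arc_length \<gamma> 0 1"
proof -
  \<comment> \<open>The half-open \<open>{-1<..1}\<close> contains \<open>{0..1}\<close> and suits
    \<open>emeasure_arc_measure_Ioc\<close>; its mass is the full length because the arc length
    function is 0 at \<open>-1\<close>.\<close>
  have "arc_integral \<gamma> w \<le> (\<integral>\<^sup>+ t. c * indicator {-1<..1} t \<partial>arc_measure \<gamma>)"
    unfolding arc_integral_def using w by (intro nn_integral_mono) (auto split: split_indicator)
  also have "\<dots> = c * emeasure (arc_measure \<gamma>) {-1<..1}"
    by (rule nn_integral_cmult_indicator) simp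
  also have "emeasure (arc_measure \<gamma>) {-1<..1} = arc_length \<gamma> 0 1"
    using emeasure_arc_measure_Ioc[OF \<gamma>, of "-1" 1] \<gamma>(2) by simp
  finally show ?thesis .
qed

text \<open>Only the portion over \<open>{a<..b}\<close> is counted, whose mass is at least the
  chord length by superadditivity. The open left end allows portions that start inside a cluster,
  where the weight is small.\<close>

lemma arc_integral_ge:
  assumes \<gamma>: "path \<gamma>" "arc_length \<gamma> 0 1 < \<infinity>" and ab: "0 \<le> a" "a \<le> b" "b \<le> 1"
    and w: "\<And>t. t \<in> {a<..b} \<Longrightarrow> c \<le> w (\<gamma> t)"
  shows "c * ennreal (dist (\<gamma> a) (\<gamma> b)) \<le> arc_integral \<gamma> w"
proof -
  have fin: "arc_length \<gamma> u v < \<infinity>" if "0 \<le> u" "v \<le> 1" for u v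
    using arc_length_mono[OF that, of \<gamma>] \<gamma>(2) by (rule le_less_trans)
  have "ennreal (dist (\<gamma> a) (\<gamma> b)) \<le> arc_length \<gamma> a b"
    using ab by (intro dist_le_arc_length) auto
  moreover have "arc_length \<gamma> 0 a + arc_length \<gamma> a b \<le> arc_length \<gamma> 0 b"
    using ab by (intro arc_length_superadd) auto
  ultimately have "ennreal (dist (\<gamma> a) (\<gamma> b)) \<le>
      ennreal (enn2real (arc_length \<gamma> 0 b) - enn2real (arc_length \<gamma> 0 a))"
    using fin[of 0 a] fin[of a b] fin[of 0 b] ab
    by (cases "arc_length \<gamma> 0 a"; cases "arc_length \<gamma> a b"; cases "arc_length \<gamma> 0 b")
      (auto simp flip: ennreal_plus)
  also have "\<dots> = emeasure (arc_measure \<gamma>) {a<..b}"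
    using emeasure_arc_measure_Ioc[OF \<gamma> ab(2)] ab by simp
  finally have "c * ennreal (dist (\<gamma> a) (\<gamma> b)) \<le> c * emeasure (arc_measure \<gamma>) {a<..b}"
    by (rule mult_left_mono) simp
  also have "\<dots> = (\<integral>\<^sup>+ t. c * indicator {a<..b} t \<partial>arc_measure \<gamma>)"
    by (rule nn_integral_cmult_indicator[symmetric]) simp
  also have "\<dots> \<le> arc_integral \<gamma> w"
    unfolding arc_integral_def using w ab by (intro nn_integral_mono) (auto split: split_indicator)
  finally show ?thesis .
qed

section \<open>Fermat distances within and between clusters\<close>

text \<open>Half of the reach, because the supremum defining the reach need not be attained.  If it is
  infinite, every radius is admissible.\<close>

definition half_reach :: "ennreal \<Rightarrow> real" where
  "half_reach \<tau> = (if \<tau> = \<infinity> then 1 else enn2real \<tau> / 2)"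

lemma half_reach_pos: "0 < \<tau> \<Longrightarrow> 0 < half_reach \<tau>"
  by (auto simp: half_reach_def enn2real_positive_iff top.not_eq_extremum)

text \<open>Some admissible radius exceeds the half reach, which lies strictly below the supremum,
  and uniqueness of nearest points passes to smaller radii.\<close>

lemma tubular_nbhd_half_reach:
  assumes "compact C" "C \<noteq> {}" "0 < reach C"
  shows "tubular_nbhd C (half_reach (reach C))"
proof
  let ?r = "half_reach (reach C)"
  show "0 < ?r"
    using assms(3) by (rule half_reach_pos)
  fix y assume y: "infdist y C \<le> ?r"
  have "ennreal ?r < reach C"
  proof (cases "reach C")
    case (real \<tau>)
    then show ?thesis
      using assms(3) by (simp add: half_reach_def ennreal_less_iff)
  qed (simp add: half_reach_def)
  then obtain r where r: "0 < r" "ennreal ?r < ennreal r"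
      "\<And>y. infdist y C \<le> r \<Longrightarrow> \<exists>!x. x \<in> C \<and> dist x y = infdist y C"
    unfolding reach_def less_SUP_iff by auto
  then have "?r < r"
    using \<open>0 < ?r\<close> by (simp add: ennreal_less_iff)
  with y show "\<exists>!x. x \<in> C \<and> dist x y = infdist y C"
    by (intro r(3)) simp
qed (use assms in auto)

text \<open>Points of \<open>C\<close> at distance at most \<open>r\<close> lie in a connected
  subset of \<open>C\<close>, which cannot meet both the closed set \<open>P i\<close> and the
  disjoint closed union of the other pieces.\<close>

lemma (in tubular_nbhd) near_cluster_member:
  assumes C: "C = (\<Union>i\<in>I. P i)" and I: "finite I" "\<And>i. i \<in> I \<Longrightarrow> closed (P i)" "disjoint_family_on P I"
    and xy: "i \<in> I" "x \<in> P i" "y \<in> C" "dist x y \<le> r"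
  shows "y \<in> P i"
proof (rule ccontr)
  assume y: "y \<notin> P i"
  let ?Q = "\<Union>j\<in>I - {i}. P j"
  have "x \<in> C"
    using xy C by blast
  with xy obtain K where K: "connected K" "K \<subseteq> C" "x \<in> K" "y \<in> K"
    using lip_joined_near lip_joined_connected by meson
  have "P i \<inter> ?Q \<inter> K = {}"
    using I(3) xy(1) unfolding disjoint_family_on_def by blast
  moreover have "K \<subseteq> P i \<union> ?Q"
    using K(2) C by blast
  moreover have "closed ?Q"
    using I by (intro closed_UN) auto
  ultimately have "P i \<inter> K = {} \<or> ?Q \<inter> K = {}"
    using K(1) I(2) xy(1) by (intro connected_closedD) auto
  moreover have "y \<in> ?Q"
    using xy(3) y C by blast
  ultimately show False
    using K(3,4) xy(2) by blast
qed

text \<open>\<open>b\<close> is the first time at distance at least \<open>r\<close> from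
  \<open>P\<close>, and \<open>a\<close> is the last time before \<open>b\<close> in
  \<open>P\<close>.\<close>

lemma path_crosses_collar:
  fixes \<gamma> :: "real \<Rightarrow> 'a::heine_borel"
  assumes \<gamma>: "path \<gamma>" and P: "closed P" "\<gamma> 0 \<in> P" and r: "0 < r" "r \<le> infdist (\<gamma> 1) P"
  obtains a b where "0 \<le> a" "a \<le> b" "b \<le> 1" "r \<le> dist (\<gamma> a) (\<gamma> b)"
    "\<And>t. t \<in> {a<..b} \<Longrightarrow> 0 < infdist (\<gamma> t) P \<and> infdist (\<gamma> t) P \<le> r"
proof -
  define h where "h t = infdist (\<gamma> t) P" for t
  have h: "continuous_on {0..1} h"
    using \<gamma> unfolding h_def path_def by (intro continuous_intros)
  have sub: "continuous_on {0..b} h" if "b \<le> 1" for b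
    using that by (intro continuous_on_subset[OF h]) auto
  have "compact {t \<in> {0..1}. r \<le> h t}"
    using continuous_on_closed_Collect_le[OF continuous_on_const h closed_atLeastAtMost]
    by (auto simp: compact_eq_bounded_closed intro: bounded_subset[of "{0..1}"])
  moreover have "1 \<in> {t \<in> {0..1}. r \<le> h t}"
    using r by (simp add: h_def)
  ultimately obtain b where b: "b \<in> {0..1}" "r \<le> h b" "\<And>t. t \<in> {0..1} \<Longrightarrow> r \<le> h t \<Longrightarrow> b \<le> t"
    using compact_attains_inf[of "{t \<in> {0..1}. r \<le> h t}"] by blast
  have h0: "h 0 = 0"
    using P(2) by (simp add: h_def)
  \<comment> \<open>The value \<open>r\<close> is attained no later than \<open>b\<close>, and
    \<open>b\<close> is the first time with \<open>r \<le> h b\<close>; so \<open>h b = r\<close>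
    exactly.\<close>
  obtain c where "0 \<le> c" "c \<le> b" "h c = r"
    using IVT'[of h 0 r b] h0 r(1) b(1,2) sub[of b] by auto
  with b have hb: "h b = r"
    by (metis antisym atLeastAtMost_iff order_refl order_trans)
  have le: "h t \<le> r" if "t \<in> {0..b}" for t
    using b(3)[of t] that b(1) hb by (cases "r \<le> h t") auto
  have "compact {t \<in> {0..b}. h t \<le> 0}"
    using b(1) continuous_on_closed_Collect_le[OF sub continuous_on_const closed_atLeastAtMost]
    by (auto simp: compact_eq_bounded_closed intro: bounded_subset[of "{0..b}"])
  moreover have "0 \<in> {t \<in> {0..b}. h t \<le> 0}"
    using h0 b(1) by simp
  ultimately obtain a where a: "a \<in> {0..b}" "h a \<le> 0" "\<And>t. t \<in> {0..b} \<Longrightarrow> h t \<le> 0 \<Longrightarrow> t \<le> a"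
    using compact_attains_sup[of "{t \<in> {0..b}. h t \<le> 0}"] by blast
  have "\<gamma> a \<in> P"
    using a(2) in_closed_iff_infdist_zero[OF P(1), of "\<gamma> a"] P(2) infdist_nonneg[of "\<gamma> a" P]
    by (auto simp: h_def)
  then have "h b \<le> dist (\<gamma> a) (\<gamma> b)"
    by (simp add: h_def infdist_le dist_commute[of "\<gamma> a"])
  moreover have "0 < h t \<and> h t \<le> r" if "t \<in> {a<..b}" for t
    using a(1) a(3)[of t] le[of t] that by (cases "h t \<le> 0") auto
  ultimately show thesis
    using a(1) b(1) hb by (intro that[of a b]) (auto simp: h_def)
qed

section \<open>Bounds for the Fermat weight and the Fermat distance\<close>

lemma fermat_weight_le:
  assumes "1 < \<alpha>" "1 \<le> d" "0 < a" "a \<le> f z"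
  shows "fermat_weight d \<alpha> f z \<le> ennreal (1 / a powr ((\<alpha> - 1) / real d))"
proof -
  let ?s = "(\<alpha> - 1) / real d"
  have "a powr ?s \<le> f z powr ?s"
    using assms by (intro powr_mono2) auto
  then have "1 / f z powr ?s \<le> 1 / a powr ?s"
    using assms by (intro divide_left_mono) auto
  moreover have "fermat_weight d \<alpha> f z = ennreal (1 / f z powr ?s)"
    using assms by (simp add: fermat_weight_def divide_ennreal flip: ennreal_1)
  ultimately show ?thesis
    by (simp add: ennreal_leI)
qed

lemma fermat_weight_ge:
  assumes "1 < \<alpha>" "1 \<le> d" "0 \<le> f z" "f z \<le> a"
  shows "ennreal (1 / a powr ((\<alpha> - 1) / real d)) \<le> fermat_weight d \<alpha> f z"
proof (cases "f z = 0")
  \<comment> \<open>Where the density vanishes the weight is infinite, because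
    \<open>\<alpha> > 1\<close>.\<close>
  case True
  then show ?thesis
    using assms by (simp add: fermat_weight_def)
next
  case False
  let ?s = "(\<alpha> - 1) / real d"
  have "f z powr ?s \<le> a powr ?s"
    using assms by (intro powr_mono2) auto
  then have "1 / a powr ?s \<le> 1 / f z powr ?s"
    using assms False by (intro divide_left_mono) auto
  moreover have "fermat_weight d \<alpha> f z = ennreal (1 / f z powr ?s)"
    using assms False by (simp add: fermat_weight_def divide_ennreal flip: ennreal_1)
  ultimately show ?thesis
    by (simp add: ennreal_leI)
qed

lemma fermat_dist_le:
  assumes "1 < \<alpha>" "1 \<le> d" "0 < a" and S: "S \<subseteq> M" "\<And>z. z \<in> S \<Longrightarrow> a \<le> f z"
    and "lip_joined S L x y"
  shows "fermat_dist d \<alpha> M f x y \<le> ennreal (1 / a powr ((\<alpha> - 1) / real d) * L)"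
proof -
  obtain g where g: "0 \<le> L" "1-lipschitz_on {0..L} g" "g ` {0..L} \<subseteq> S" "g 0 = x" "g L = y"
    using assms(6) by (auto simp: lip_joined_def)
  \<comment> \<open>Rescaling time to \<open>[0, 1]\<close> turns speed 1 into speed
    \<open>L\<close>, so the length is at most \<open>L\<close>.\<close>
  define \<gamma> where "\<gamma> t = g (L * t)" for t
  have L: "L * t \<in> {0..L}" if "t \<in> {0..1}" for t
    using that g(1) by (auto simp: mult_left_le)
  have lip: "L-lipschitz_on {0..1} \<gamma>"
  proof (rule lipschitz_onI)
    fix s t :: real assume "s \<in> {0..1}" "t \<in> {0..1}"
    then have "dist (\<gamma> s) (\<gamma> t) \<le> 1 * dist (L * s) (L * t)"
      unfolding \<gamma>_def by (intro lipschitz_onD[OF g(2)] L)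
    also have "\<dots> = L * dist s t"
      using g(1) by (simp add: dist_real_def abs_mult flip: right_diff_distrib)
    finally show "dist (\<gamma> s) (\<gamma> t) \<le> L * dist s t" .
  qed (fact g(1))
  have path: "path \<gamma>"
    unfolding path_def using lip by (rule lipschitz_on_continuous_on)
  have len: "arc_length \<gamma> 0 1 \<le> ennreal L"
    using arc_length_lipschitz[OF lip] by simp
  then have fin: "arc_length \<gamma> 0 1 < \<infinity>"
    using ennreal_less_top le_less_trans by fastforce
  have \<gamma>S: "\<gamma> t \<in> S" if "t \<in> {0..1}" for t
    using g(3) L[OF that] by (auto simp: \<gamma>_def)
  then have "\<gamma> \<in> rectifiable_paths M x y"
    using path fin S(1) g(4,5)
    by (auto simp: rectifiable_paths_def path_image_def pathstart_def pathfinish_def \<gamma>_def)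
  then have "fermat_dist d \<alpha> M f x y \<le> arc_integral \<gamma> (fermat_weight d \<alpha> f)"
    unfolding fermat_dist_def by (rule INF_lower)
  also have "\<dots> \<le> ennreal (1 / a powr ((\<alpha> - 1) / real d)) * arc_length \<gamma> 0 1"
    using path fin by (rule arc_integral_le) (use assms \<gamma>S in \<open>auto intro: fermat_weight_le\<close>)
  also have "\<dots> \<le> ennreal (1 / a powr ((\<alpha> - 1) / real d)) * ennreal L"
    using len by (rule mult_left_mono) simp
  also have "\<dots> = ennreal (1 / a powr ((\<alpha> - 1) / real d) * L)"
    using g(1) by (intro ennreal_mult[symmetric]) auto
  finally show ?thesis .
qed

text \<open>Every path from \<open>x\<close> to \<open>y\<close> crosses the collar of width
  \<open>r\<close> around \<open>P\<close>, where the weight is large.\<close>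

lemma fermat_dist_ge:
  assumes "1 < \<alpha>" "1 \<le> d" "closed P" "x \<in> P" "0 < r" "r \<le> infdist y P"
    and f: "\<And>z. z \<in> M \<Longrightarrow> 0 < infdist z P \<Longrightarrow> infdist z P \<le> r \<Longrightarrow> 0 \<le> f z \<and> f z \<le> a"
  shows "ennreal (1 / a powr ((\<alpha> - 1) / real d) * r) \<le> fermat_dist d \<alpha> M f x y"
  unfolding fermat_dist_def
proof (rule INF_greatest)
  fix \<gamma> assume "\<gamma> \<in> rectifiable_paths M x y"
  then have \<gamma>: "path \<gamma>" "arc_length \<gamma> 0 1 < \<infinity>" "\<gamma> ` {0..1} \<subseteq> M" "\<gamma> 0 = x" "\<gamma> 1 = y"
    by (auto simp: rectifiable_paths_def path_image_def pathstart_def pathfinish_def)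
  let ?c = "1 / a powr ((\<alpha> - 1) / real d)"
  obtain u v where uv: "0 \<le> u" "u \<le> v" "v \<le> 1" "r \<le> dist (\<gamma> u) (\<gamma> v)"
      "\<And>t. t \<in> {u<..v} \<Longrightarrow> 0 < infdist (\<gamma> t) P \<and> infdist (\<gamma> t) P \<le> r"
    using path_crosses_collar[OF \<gamma>(1) assms(3), of r] \<gamma>(4,5) assms(4-6) by blast
  have w: "ennreal ?c \<le> fermat_weight d \<alpha> f (\<gamma> t)" if t: "t \<in> {u<..v}" for t
  proof -
    have "\<gamma> t \<in> M"
      using \<gamma>(3) t uv(1,3) by auto
    with f[of "\<gamma> t"] uv(5)[OF t] show ?thesis
      using assms(1,2) by (intro fermat_weight_ge) auto
  qed
  have "ennreal (?c * r) \<le> ennreal (?c * dist (\<gamma> u) (\<gamma> v))"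
    using uv(4) by (intro ennreal_leI mult_left_mono) auto
  also have "\<dots> = ennreal ?c * ennreal (dist (\<gamma> u) (\<gamma> v))"
    by (intro ennreal_mult) auto
  also have "\<dots> \<le> arc_integral \<gamma> (fermat_weight d \<alpha> f)"
    using \<gamma>(1,2) uv(1-3) w by (rule arc_integral_ge)
  finally show "ennreal (?c * r) \<le> arc_integral \<gamma> (fermat_weight d \<alpha> f)" .
qed

section \<open>Feasibility from separated distance bounds\<close>

lemma alpha_feasibleI:
  fixes C :: "nat \<Rightarrow> 'a::euclidean_space set"
  assumes "U < V" "0 \<le> U"
    and "\<And>i x y. i \<in> {1..m} \<Longrightarrow> x \<in> C i \<Longrightarrow> y \<in> C i \<Longrightarrow> fermat_dist d \<alpha> M f x y \<le> ennreal U"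
    and "\<And>i j x y. i \<in> {1..m} \<Longrightarrow> j \<in> {1..m} - {i} \<Longrightarrow> x \<in> C i \<Longrightarrow> y \<in> C j \<Longrightarrow>
      ennreal V \<le> fermat_dist d \<alpha> M f x y"
  shows "alpha_feasible d \<alpha> M m C f"
  unfolding alpha_feasible_def
proof (intro exI[of _ "V - U"] conjI ballI)
  fix i j x y y' assume *: "i \<in> {1..m}" "j \<in> {1..m} - {i}" "x \<in> C i" "y \<in> C i" "y' \<in> C j"
  have "enn2ereal (fermat_dist d \<alpha> M f x y) \<le> enn2ereal (ennreal U)"
    using assms(3) * by (simp flip: less_eq_ennreal.rep_eq)
  also have "\<dots> = enn2ereal (ennreal V) - ereal (V - U)"
    using assms(1,2) by simp
  also have "\<dots> \<le> enn2ereal (fermat_dist d \<alpha> M f x y') - ereal (V - U)"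
    using assms(4) * by (intro ereal_minus_mono) (auto simp flip: less_eq_ennreal.rep_eq)
  finally show "enn2ereal (fermat_dist d \<alpha> M f x y) \<le> enn2ereal (fermat_dist d \<alpha> M f x y') - ereal (V - U)" .
qed (use assms(1) in simp)

text \<open>With \<open>s = (\<alpha> - 1) / d\<close>, the bound on \<open>\<alpha>\<close> says
  that \<open>\<kappa> < (a\<^sub>1 / a\<^sub>0) powr s\<close>, so the bound within a cluster stays
  below the cost of crossing a collar.\<close>

lemma clustering_feasible:
  fixes C :: "nat \<Rightarrow> 'a::euclidean_space set"
  assumes set: "clustering_setting d M f m C a\<^sub>0 a\<^sub>1"
    and N: "\<And>S :: 'a set. bounded S \<Longrightarrow> diameter S \<le> Max (set (diameters m C)) \<Longrightarrow>
       \<exists>F. finite F \<and> card F \<le> N \<and> F \<subseteq> S \<and>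
         S \<subseteq> (\<Union>c\<in>F. ball c (half_reach (reach (\<Union>i\<in>{1..m}. C i)) / 2))"
    and \<alpha>: "\<alpha> > 1 + real d * (ln (2 * real (N * N + 2)) / ln (a\<^sub>1 / a\<^sub>0))"
  shows "alpha_feasible d \<alpha> M m C f"
proof (cases "(\<Union>i\<in>{1..m}. C i) = {}")
  case True
  then show ?thesis
    by (intro alpha_feasibleI[of 0 1]) auto
next
  case False
  let ?C = "\<Union>i\<in>{1..m}. C i"
  define r where "r = half_reach (reach ?C)"
  define \<kappa> where "\<kappa> = 2 * real (N * N + 2)"
  define s where "s = (\<alpha> - 1) / real d"
  have d: "1 \<le> d" and f0: "\<And>x. x \<in> M \<Longrightarrow> 0 \<le> f x"
    and Ci: "\<And>i. i \<in> {1..m} \<Longrightarrow> compact (C i) \<and> connected (C i) \<and> C i \<subseteq> M"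
    and disj: "disjoint_family_on C {1..m}" and reach: "0 < reach ?C"
    and a: "0 < a\<^sub>0" "a\<^sub>0 < a\<^sub>1"
    and f1: "\<And>x. x \<in> ?C \<Longrightarrow> a\<^sub>1 \<le> f x" and f2: "\<And>x. x \<in> M - ?C \<Longrightarrow> f x \<le> a\<^sub>0"
    using set unfolding clustering_setting_def prob_density_on_def by blast+
  have cl: "closed (C i)" if "i \<in> {1..m}" for i
    using Ci that compact_imp_closed by blast
  have "compact ?C"
    using Ci by (intro compact_UN) auto
  then interpret tubular_nbhd ?C r
    unfolding r_def using False reach by (rule tubular_nbhd_half_reach)
  have \<kappa>: "4 \<le> \<kappa>"
    by (simp add: \<kappa>_def)
  have ln_pos: "0 < ln (a\<^sub>1 / a\<^sub>0)"
    using a by simp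
  have "0 \<le> ln \<kappa> / ln (a\<^sub>1 / a\<^sub>0)"
    using \<kappa> ln_pos by simp
  with \<alpha> have \<alpha>1: "1 < \<alpha>"
    unfolding \<kappa>_def[symmetric] by (smt (verit) mult_nonneg_nonneg of_nat_0_le_iff)
  have "ln \<kappa> / ln (a\<^sub>1 / a\<^sub>0) < s"
    using \<alpha> d unfolding s_def \<kappa>_def by (simp add: field_simps)
  then have "ln \<kappa> < s * ln (a\<^sub>1 / a\<^sub>0)"
    using ln_pos by (simp add: field_simps)
  then have "exp (ln \<kappa>) < exp (s * ln (a\<^sub>1 / a\<^sub>0))"
    by (simp only: exp_less_cancel_iff)
  then have "\<kappa> < (a\<^sub>1 / a\<^sub>0) powr s"
    using \<kappa> a by (simp add: powr_def)
  then have "\<kappa> < a\<^sub>1 powr s / a\<^sub>0 powr s"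
    using a by (simp add: powr_divide)
  then have lt: "1 / a\<^sub>1 powr s * (\<kappa> * r) < 1 / a\<^sub>0 powr s * r"
    using a r_pos by (simp add: field_simps)
  show ?thesis
  proof (rule alpha_feasibleI[OF lt])
    show "0 \<le> 1 / a\<^sub>1 powr s * (\<kappa> * r)"
      using \<kappa> r_pos by simp
  next
    fix i x y assume i: "i \<in> {1..m}" and xy: "x \<in> C i" "y \<in> C i"
    \<comment> \<open>Passing to the largest diameter lets one \<open>N\<close> serve all
      clusters.\<close>
    have "diameter (C i) \<in> set (diameters m C)"
      using i by (auto simp: diameters_def simp del: upt_Suc)
    then have "diameter (C i) \<le> Max (set (diameters m C))"
      by (intro Max_ge) auto
    then obtain F where F: "finite F" "card F \<le> N" "F \<subseteq> C i" "C i \<subseteq> (\<Union>c\<in>F. ball c (r / 2))"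
      using N[of "C i"] Ci[OF i] compact_imp_bounded[of "C i"] unfolding r_def by auto
    have "lip_joined ?C (real (N * N + 2) * (2 * r)) x y"
      using Ci[OF i] i by (intro lip_joined_cover[OF _ _ F xy]) auto
    then have "lip_joined ?C (\<kappa> * r) x y"
      by (simp add: \<kappa>_def algebra_simps)
    moreover have "?C \<subseteq> M"
      using Ci by blast
    ultimately show "fermat_dist d \<alpha> M f x y \<le> ennreal (1 / a\<^sub>1 powr s * (\<kappa> * r))"
      unfolding s_def using a f1 by (intro fermat_dist_le[OF \<alpha>1 d, where S = ?C]) auto
  next
    fix i j x y assume i: "i \<in> {1..m}" and j: "j \<in> {1..m} - {i}" and x: "x \<in> C i" and y: "y \<in> C j"
    \<comment> \<open>This serves twice: it puts \<open>y\<close> beyond the collar and keeps the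
      collar free of points of \<open>C\<close>.\<close>
    have near: "z \<in> C i" if z: "z \<in> ?C" "infdist z (C i) \<le> r" for z
    proof -
      obtain p where "p \<in> C i" "infdist z (C i) = dist z p"
        using infdist_attains_inf[OF cl[OF i]] x by blast
      then show ?thesis
        using near_cluster_member[OF refl _ cl disj i, of p z] z by (simp add: dist_commute)
    qed
    have "y \<notin> C i"
      using disj i j y unfolding disjoint_family_on_def by blast
    then have y_far: "r \<le> infdist y (C i)"
      using near[of y] j y by (meson DiffD1 UN_I le_cases)
    show "ennreal (1 / a\<^sub>0 powr s * r) \<le> fermat_dist d \<alpha> M f x y"
      unfolding s_def
    proof (rule fermat_dist_ge[OF \<alpha>1 d cl[OF i] x r_pos y_far])
      fix z assume z: "z \<in> M" "0 < infdist z (C i)" "infdist z (C i) \<le> r"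
      have "z \<notin> ?C"
      proof
        assume "z \<in> ?C"
        then have "z \<in> C i"
          using z(3) by (rule near)
        with z(2) show False
          by simp
      qed
      then show "0 \<le> f z \<and> f z \<le> a\<^sub>0"
        using f0 f2 z(1) by blast
    qed
  qed
qed

theorem proposition2p2:
  shows
    "(\<exists>\<beta>\<^sub>0 :: real list \<Rightarrow> ennreal \<Rightarrow> nat \<Rightarrow> real.
        (\<forall>\<delta> \<tau> d. 0 \<le> \<beta>\<^sub>0 \<delta> \<tau> d) \<and>
        (\<forall>d (M :: (real ^ 'D) set) f m C a\<^sub>0 a\<^sub>1 \<alpha>.
           clustering_setting d M f m C a\<^sub>0 a\<^sub>1 \<longrightarrow>
           \<alpha> > 1 + real d * (\<beta>\<^sub>0 (diameters m C) (reach (\<Union>i\<in>{1..m}. C i)) d / ln (a\<^sub>1 / a\<^sub>0)) \<longrightarrow>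
           alpha_feasible d \<alpha> M m C f)) \<and>
     (\<exists>\<beta>\<^sub>0 :: real \<Rightarrow> real list \<Rightarrow> ennreal \<Rightarrow> real.
        (\<forall>R \<delta> \<tau>. 0 \<le> \<beta>\<^sub>0 R \<delta> \<tau>) \<and>
        (\<forall>d (M :: (real ^ 'D) set) f m C a\<^sub>0 a\<^sub>1 \<alpha> R.
           clustering_setting d M f m C a\<^sub>0 a\<^sub>1 \<longrightarrow>
           geodesics_bounded m C R \<longrightarrow>
           \<alpha> > 1 + real d * (\<beta>\<^sub>0 R (diameters m C) (reach (\<Union>i\<in>{1..m}. C i)) / ln (a\<^sub>1 / a\<^sub>0)) \<longrightarrow>
           alpha_feasible d \<alpha> M m C f))"
proof -
  let ?P = "\<lambda>N \<delta> \<epsilon>. \<forall>S :: (real ^ 'D) set. bounded S \<longrightarrow> diameter S \<le> \<delta> \<longrightarrow>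
      (\<exists>F. finite F \<and> card F \<le> N \<and> F \<subseteq> S \<and> S \<subseteq> (\<Union>c\<in>F. ball c \<epsilon>))"
  \<comment> \<open>Choosing \<open>N\<close> as a function before any manifold, density or
    \<open>d\<close> is fixed makes the constant depend only on diameters and reach.\<close>
  have "\<exists>N :: real \<Rightarrow> real \<Rightarrow> nat. \<forall>\<delta> \<epsilon>. 0 < \<epsilon> \<longrightarrow> ?P (N \<delta> \<epsilon>) \<delta> \<epsilon>"
  proof (intro choice allI)
    fix \<delta> \<epsilon> :: real
    show "\<exists>N. 0 < \<epsilon> \<longrightarrow> ?P N \<delta> \<epsilon>"
      by (cases "0 < \<epsilon>") (simp_all add: diameter_cover_bound)
  qed
  then obtain N :: "real \<Rightarrow> real \<Rightarrow> nat" where N: "\<forall>\<delta> \<epsilon>. 0 < \<epsilon> \<longrightarrow> ?P (N \<delta> \<epsilon>) \<delta> \<epsilon>" ..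
  define \<beta> where "\<beta> \<delta> \<tau> = (let n = N (Max (set \<delta>)) (half_reach \<tau> / 2) in ln (2 * real (n * n + 2)))"
    for \<delta> \<tau>
  have \<beta>_nonneg: "0 \<le> \<beta> \<delta> \<tau>" for \<delta> \<tau>
    by (simp add: \<beta>_def Let_def)
  have feasible: "alpha_feasible d \<alpha> M m C f"
    if set: "clustering_setting d M f m C a\<^sub>0 a\<^sub>1"
      and \<alpha>: "\<alpha> > 1 + real d * (\<beta> (diameters m C) (reach (\<Union>i\<in>{1..m}. C i)) / ln (a\<^sub>1 / a\<^sub>0))"
    for d and M :: "(real ^ 'D) set" and f m C a\<^sub>0 a\<^sub>1 \<alpha>
  proof (rule clustering_feasible[OF set])
    have pos: "0 < half_reach (reach (\<Union>i\<in>{1..m}. C i)) / 2"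
      using set by (simp add: clustering_setting_def half_reach_pos)
    show "\<exists>F. finite F \<and> card F \<le> N (Max (set (diameters m C))) (half_reach (reach (\<Union>i\<in>{1..m}. C i)) / 2) \<and>
        F \<subseteq> S \<and> S \<subseteq> (\<Union>c\<in>F. ball c (half_reach (reach (\<Union>i\<in>{1..m}. C i)) / 2))"
      if "bounded S" "diameter S \<le> Max (set (diameters m C))"
      for S :: "(real ^ 'D) set"
      using N[rule_format, OF pos that] .
  qed (use \<alpha> in \<open>simp add: \<beta>_def Let_def\<close>)
  show ?thesis
  proof (intro conjI)
    show "\<exists>\<beta>\<^sub>0 :: real list \<Rightarrow> ennreal \<Rightarrow> nat \<Rightarrow> real. (\<forall>\<delta> \<tau> d. 0 \<le> \<beta>\<^sub>0 \<delta> \<tau> d) \<and>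
        (\<forall>d (M :: (real ^ 'D) set) f m C a\<^sub>0 a\<^sub>1 \<alpha>.
           clustering_setting d M f m C a\<^sub>0 a\<^sub>1 \<longrightarrow>
           \<alpha> > 1 + real d * (\<beta>\<^sub>0 (diameters m C) (reach (\<Union>i\<in>{1..m}. C i)) d / ln (a\<^sub>1 / a\<^sub>0)) \<longrightarrow>
           alpha_feasible d \<alpha> M m C f)"
      by (rule exI[of _ "\<lambda>\<delta> \<tau> _. \<beta> \<delta> \<tau>"]) (intro conjI allI impI \<beta>_nonneg; rule feasible)
    show "\<exists>\<beta>\<^sub>0 :: real \<Rightarrow> real list \<Rightarrow> ennreal \<Rightarrow> real. (\<forall>R \<delta> \<tau>. 0 \<le> \<beta>\<^sub>0 R \<delta> \<tau>) \<and>
        (\<forall>d (M :: (real ^ 'D) set) f m C a\<^sub>0 a\<^sub>1 \<alpha> R.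
           clustering_setting d M f m C a\<^sub>0 a\<^sub>1 \<longrightarrow>
           geodesics_bounded m C R \<longrightarrow>
           \<alpha> > 1 + real d * (\<beta>\<^sub>0 R (diameters m C) (reach (\<Union>i\<in>{1..m}. C i)) / ln (a\<^sub>1 / a\<^sub>0)) \<longrightarrow>
           alpha_feasible d \<alpha> M m C f)"
      by (rule exI[of _ "\<lambda>_. \<beta>"]) (intro conjI allI impI \<beta>_nonneg; rule feasible)
  qed
qed

end
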